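(* Fix $\alpha\in(0,1)$, an integer $n\geq 1$, and a model class $\mathcal{F}$. Then $$\hat{L}_\alpha^{\mathrm{ERM}}(\mathcal{F},\mathcal{D}_n) := \alpha\cdot \hat{R}(\mathcal{F},\mathcal{D}_n)$$ is a valid distribution-free lower bound on the model class risk $R_P(\mathcal{F})$; that is, for every probability distribution $P$ on $\mathcal{Z}$, $\mathbb{P}_P\{R_P(\mathcal{F})\geq \alpha\cdot\hat R(\mathcal{F},\mathcal{D}_n)\}\geq 1-\alpha$.
   Context: Let $\mathcal{Z}$ be the (measurable) data space, $\mathcal{F}$ a set of models (the model class), and $\ell:\mathcal{F}\times\mathcal{Z}\to[0,\infty)$ a loss function. For a probability distribution $P$ on $\mathcal{Z}$ the risk of $f\in\mathcal{F}$ is $R_P(f)=\mathbb{E}_P[\ell(f,Z)]$ with $Z\sim P$, and the model class risk is $R_P(\mathcal{F})=\inf_{f\in\mathcal{F}}R_P(f)$. For a data set $\mathcal{D}_n=(Z_1,\dots,Z_n)\in\mathcal{Z}^n$, the empirical risk is $\hat{R}(f,\mathcal{D}_n)=\frac1n\sum_{i=1}^n\ell(f,Z_i)$ and $\hat{R}(\mathcal{F},\mathcal{D}_n)=\inf_{f\in\mathcal{F}}\hat{R}(f,\mathcal{D}_n)$. $\mathbb{P}_P$ denotes probability when $\mathcal{D}_n\sim P^n$ (i.i.d. draws from $P$). A map $\hat{L}_\alpha(\mathcal{F},\cdot):\mathcal{Z}^n\to[0,\infty]$ is a valid distribution-free lower bound on the model class risk of $\mathcal{F}$ if $\mathbb{P}_P\{R_P(\mathcal{F})\geq\hat{L}_\alpha(\mathcal{F},\mathcal{D}_n)\}\geq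 1-\alpha$ for all distributions $P$ on $\mathcal{Z}$. All functions, infima and events involved are implicitly assumed measurable so that expectations and probabilities are defined. *)

theory Defs
  imports "HOL-Probability.Probability"
begin

text \<open>
  Risks and lower bounds take values in \<^typ>\<open>ennreal\<close>, since the expectation of a nonnegative
  loss may be infinite and a lower bound ranges over $[0,\infty]$; an infimum over the empty
  model class is \<^term>\<open>\<infinity> :: ennreal\<close>. The conversion \<^const>\<open>ennreal\<close> truncates negative reals
  to 0, so these definitions are meant for nonnegative losses.
\<close>

definition risk :: "('f \<Rightarrow> 'z \<Rightarrow> real) \<Rightarrow> 'z measure \<Rightarrow> 'f \<Rightarrow> ennreal" where
  "risk l P f = (\<integral>\<^sup>+ z. ennreal (l f z) \<partial>P)"

definition class_risk :: "('f \<Rightarrow> 'z \<Rightarrow> real) \<Rightarrow> 'z measure \<Rightarrow> 'f set \<Rightarrow> ennreal" where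
  "class_risk l P F = (INF f\<in>F. risk l P f)"

definition emp_risk :: "('f \<Rightarrow> 'z \<Rightarrow> real) \<Rightarrow> nat \<Rightarrow> 'f \<Rightarrow> (nat \<Rightarrow> 'z) \<Rightarrow> real" where
  "emp_risk l n f D = (1 / real n) * (\<Sum>i=1..n. l f (D i))"

definition emp_class_risk :: "('f \<Rightarrow> 'z \<Rightarrow> real) \<Rightarrow> nat \<Rightarrow> 'f set \<Rightarrow> (nat \<Rightarrow> 'z) \<Rightarrow> ennreal" where
  "emp_class_risk l n F D = (INF f\<in>F. ennreal (emp_risk l n f D))"

text \<open>
  The measure \<open>M\<close> only provides the measurable space: its own values are irrelevant. The law of
  \<open>n\<close> i.i.d. draws from \<open>P\<close> is the product measure on functions with index set \<open>{1..n}\<close>.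
\<close>

definition valid_lower_bound ::
  "'z measure \<Rightarrow> ('f \<Rightarrow> 'z \<Rightarrow> real) \<Rightarrow> 'f set \<Rightarrow> nat \<Rightarrow> real \<Rightarrow> ((nat \<Rightarrow> 'z) \<Rightarrow> ennreal) \<Rightarrow> bool" where
  "valid_lower_bound M l F n \<alpha> L \<longleftrightarrow>
     (\<forall>P. prob_space P \<and> sets P = sets M \<longrightarrow>
        measure (Pi\<^sub>M {1..n} (\<lambda>_. P))
          {D \<in> space (Pi\<^sub>M {1..n} (\<lambda>_. P)). class_risk l P F \<ge> L D} \<ge> 1 - \<alpha>)"

definition erm_lower_bound ::
  "('f \<Rightarrow> 'z \<Rightarrow> real) \<Rightarrow> 'f set \<Rightarrow> nat \<Rightarrow> real \<Rightarrow> (nat \<Rightarrow> 'z) \<Rightarrow> ennreal" where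
  "erm_lower_bound l F n \<alpha> D = ennreal \<alpha> * emp_class_risk l n F D"

end

theory Submission
  imports Defs
begin

text \<open>
  For a fixed model the empirical risk is an unbiased estimate of its risk. The minimal empirical
  risk lies below the empirical risk of every single model, so its expectation lies below
  every risk, hence below the infimum of the risks (\<open>nn_integral_emp_class_risk_le\<close>). The minimal
  empirical risk is therefore a nonnegative random variable with mean at most the model class risk
  \<open>r\<close>, and Markov's inequality bounds the probability that it exceeds \<open>r / \<alpha>\<close> by \<open>\<alpha>\<close>
  (\<open>prob_scaled_le_ge\<close>).
\<close>

lemma nn_integral_PiM_component:
  assumes "prob_space P" "finite I" "i \<in> I" and g: "g \<in> borel_measurable P"
  shows "(\<integral>\<^sup>+ D. g (D i) \<partial>Pi\<^sub>M I (\<lambda>_. P)) = (\<integral>\<^sup>+ z. g z \<partial>P)"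
proof -
  have "distr (Pi\<^sub>M I (\<lambda>_. P)) P (\<lambda>D. D i) = P"
    using assms by (intro distr_PiM_component) auto
  then have "(\<integral>\<^sup>+ z. g z \<partial>P) = (\<integral>\<^sup>+ z. g z \<partial>distr (Pi\<^sub>M I (\<lambda>_. P)) P (\<lambda>D. D i))"
    by simp
  also have "\<dots> = (\<integral>\<^sup>+ D. g (D i) \<partial>Pi\<^sub>M I (\<lambda>_. P))"
    using assms by (intro nn_integral_distr) auto
  finally show ?thesis by simp
qed

text \<open>
  Unbiasedness is linearity of the integral together with the fact that every observation has the
  law \<open>P\<close>.
\<close>

lemma nn_integral_emp_risk:
  assumes P: "prob_space P" and n: "n \<ge> 1"
    and nonneg: "\<And>z. z \<in> space P \<Longrightarrow> 0 \<le> l f z"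
    and meas [measurable]: "l f \<in> borel_measurable P"
  shows "(\<integral>\<^sup>+ D. ennreal (emp_risk l n f D) \<partial>Pi\<^sub>M {1..n} (\<lambda>_. P)) = risk l P f"
proof -
  let ?Q = "Pi\<^sub>M {1..n} (\<lambda>_. P)"
  have "(\<integral>\<^sup>+ D. ennreal (emp_risk l n f D) \<partial>?Q)
      = (\<integral>\<^sup>+ D. ennreal (1 / real n) * (\<Sum>i=1..n. ennreal (l f (D i))) \<partial>?Q)"
  proof (rule nn_integral_cong)
    fix D assume "D \<in> space ?Q"
    then have D: "\<And>i. i \<in> {1..n} \<Longrightarrow> 0 \<le> l f (D i)"
      by (auto simp: space_PiM PiE_iff intro: nonneg)
    have "(\<Sum>i=1..n. ennreal (l f (D i))) = ennreal (\<Sum>i=1..n. l f (D i))"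
      using D by (rule sum_ennreal)
    then show "ennreal (emp_risk l n f D)
        = ennreal (1 / real n) * (\<Sum>i=1..n. ennreal (l f (D i)))"
      using sum_nonneg[OF D] by (simp add: emp_risk_def ennreal_mult' del: times_divide_eq_left)
  qed
  also have "\<dots> = ennreal (1 / real n) * (\<Sum>i=1..n. \<integral>\<^sup>+ D. ennreal (l f (D i)) \<partial>?Q)"
    by (subst nn_integral_cmult, measurable, subst nn_integral_sum, measurable)
  also have "\<dots> = ennreal (1 / real n) * (\<Sum>i=1..n. risk l P f)"
    unfolding risk_def
    by (intro arg_cong2[where f = "(*)"] refl sum.cong
        nn_integral_PiM_component[OF P, where g = "\<lambda>z. ennreal (l f z)"]) auto
  also have "\<dots> = (ennreal (1 / real n) * ennreal (real n)) * risk l P f"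
    by (simp add: mult.assoc ennreal_of_nat_eq_real_of_nat)
  also have "ennreal (1 / real n) * ennreal (real n) = 1"
    using n by (subst ennreal_mult[symmetric]) auto
  finally show ?thesis by simp
qed

lemma nn_integral_emp_class_risk_le:
  assumes P: "prob_space P" and n: "n \<ge> 1"
    and nonneg: "\<And>f z. f \<in> F \<Longrightarrow> z \<in> space P \<Longrightarrow> 0 \<le> l f z"
    and meas: "\<And>f. f \<in> F \<Longrightarrow> l f \<in> borel_measurable P"
  shows "(\<integral>\<^sup>+ D. emp_class_risk l n F D \<partial>Pi\<^sub>M {1..n} (\<lambda>_. P)) \<le> class_risk l P F"
  unfolding class_risk_def
proof (rule INF_greatest)
  fix f assume f: "f \<in> F"
  have "(\<integral>\<^sup>+ D. emp_class_risk l n F D \<partial>Pi\<^sub>M {1..n} (\<lambda>_. P))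
      \<le> (\<integral>\<^sup>+ D. ennreal (emp_risk l n f D) \<partial>Pi\<^sub>M {1..n} (\<lambda>_. P))"
    unfolding emp_class_risk_def by (intro nn_integral_mono INF_lower f)
  also have "\<dots> = risk l P f"
    using f by (intro nn_integral_emp_risk P n nonneg meas)
  finally show "(\<integral>\<^sup>+ D. emp_class_risk l n F D \<partial>Pi\<^sub>M {1..n} (\<lambda>_. P)) \<le> risk l P f" .
qed

text \<open>
  Markov's inequality, phrased so that the degenerate means \<open>0\<close> and \<open>\<infinity>\<close> are covered: for \<open>r = 0\<close>
  the division by \<open>r\<close> is impossible, but \<open>X\<close> vanishes almost everywhere; for \<open>r = \<infinity>\<close> the event
  is the whole space.
\<close>

lemma prob_scaled_le_ge:
  assumes Q: "prob_space Q" and X [measurable]: "X \<in> borel_measurable Q"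
    and mean: "(\<integral>\<^sup>+ x. X x \<partial>Q) \<le> r" and \<alpha>: "0 \<le> \<alpha>"
  shows "measure Q {x \<in> space Q. ennreal \<alpha> * X x \<le> r} \<ge> 1 - \<alpha>"
proof -
  interpret Q: prob_space Q by (rule Q)
  define B where "B = {x \<in> space Q. r < ennreal \<alpha> * X x}"
  have B [measurable]: "B \<in> sets Q"
    unfolding B_def by measurable
  have "emeasure Q B \<le> ennreal \<alpha>"
  proof -
    consider "r = 0" | "r = \<infinity>" | "r \<noteq> 0" "r < \<infinity>"
      using top.not_eq_extremum by fastforce
    then show ?thesis
    proof cases
      case 1
      then have "AE x in Q. X x = 0"
        using mean by (simp add: nn_integral_0_iff_AE)
      then have "AE x in Q. x \<notin> B"
        by eventually_elim (simp add: B_def)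
      then have "emeasure Q B = 0"
        by (simp add: AE_iff_measurable[OF B] B_def)
      then show ?thesis by simp
    next
      case 2
      then have "B = {}" by (simp add: B_def)
      then show ?thesis by simp
    next
      case 3
      have "r * emeasure Q B = (\<integral>\<^sup>+ x. r * indicator B x \<partial>Q)"
        by (simp add: nn_integral_cmult_indicator)
      also have "\<dots> \<le> (\<integral>\<^sup>+ x. ennreal \<alpha> * X x \<partial>Q)"
        by (intro nn_integral_mono) (auto simp: B_def indicator_def)
      also have "\<dots> \<le> r * ennreal \<alpha>"
        using mean by (simp add: nn_integral_cmult mult.commute[of r] mult_left_mono)
      finally show ?thesis
        using 3 by (simp add: ennreal_mult_le_mult_iff)
    qed
  qed
  then have "Q.prob B \<le> \<alpha>"
    using \<alpha> by (simp add: Q.emeasure_eq_measure)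
  moreover have "{x \<in> space Q. ennreal \<alpha> * X x \<le> r} = space Q - B"
    by (auto simp: B_def not_less)
  ultimately show ?thesis
    by (simp add: Q.prob_compl)
qed

theorem theorem2:
  fixes M :: "'z measure" and l :: "'f \<Rightarrow> 'z \<Rightarrow> real" and F :: "'f set"
    and n :: nat and \<alpha> :: real
  assumes "0 < \<alpha>" and "\<alpha> < 1" and "n \<ge> 1"
    and "\<And>f z. f \<in> F \<Longrightarrow> z \<in> space M \<Longrightarrow> 0 \<le> l f z"
    and "\<And>f. f \<in> F \<Longrightarrow> l f \<in> borel_measurable M"
    and "emp_class_risk l n F \<in> borel_measurable (Pi\<^sub>M {1..n} (\<lambda>_. M))"
  shows "valid_lower_bound M l F n \<alpha> (erm_lower_bound l F n \<alpha>)"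
  unfolding valid_lower_bound_def erm_lower_bound_def
proof (intro allI impI)
  fix P :: "'z measure"
  assume "prob_space P \<and> sets P = sets M"
  then have P: "prob_space P" and sets_P: "sets P = sets M" by auto
  have space_P: "space P = space M"
    using sets_P by (rule sets_eq_imp_space_eq)
  let ?Q = "Pi\<^sub>M {1..n} (\<lambda>_. P)"
  show "1 - \<alpha> \<le> measure ?Q {D \<in> space ?Q. ennreal \<alpha> * emp_class_risk l n F D \<le> class_risk l P F}"
  proof (rule prob_scaled_le_ge)
    show "prob_space ?Q"
      using P by (intro prob_space_PiM)
    have "sets ?Q = sets (Pi\<^sub>M {1..n} (\<lambda>_. M))"
      using sets_P by (intro sets_PiM_cong) auto
    then show "emp_class_risk l n F \<in> borel_measurable ?Q"
      using assms(6) by (simp cong: measurable_cong_sets)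
    show "(\<integral>\<^sup>+ D. emp_class_risk l n F D \<partial>?Q) \<le> class_risk l P F"
      using assms(3-5) space_P sets_P
      by (intro nn_integral_emp_class_risk_le P) (auto cong: measurable_cong_sets)
  qed (use assms(1) in simp)
qed

end
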